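(* Let $\beta$ be one of the nine $*$-patterns $*31,\ 3{*}1,\ 31*,\ *32,\ 3{*}2,\ 32*,\ *21,\ 2{*}1,\ 21*$ (i.e. $\beta$ contains one $*$ and two integers from $\{1,2,3\}$, which appear in decreasing order). Then there are only five equivalence classes of permutations (of all lengths) under $123 \leftrightarrow \beta$. They are $\{\emptyset\}$, $\{1\}$, $\{12\}$, $\{123, 21\}$, and a fifth class containing all other permutations.
   Context: A permutation of length $n\ge 0$ is a string consisting of the integers $1,\dots,n$, each occurring exactly once; $\emptyset$ denotes the empty permutation (length $0$). Substrings are not required to be contiguous. $*$-patterns. For strings $\rho,\delta$ of distinct positive integers and symbols $*$ (several $*$'s are allowed), a (not necessarily contiguous) substring $r$ of $\rho$ is a copy of $\delta$ if $r$ and $\delta$ have $*$'s in the same positions and, ignoring all $*$'s, are order-isomorphic. Replacement. Let $\alpha,\beta$ be $*$-patterns of equal length. A permutation $\sigma$ is a result of the replacement $\alpha\to\beta$ on a permutation $\pi$ if it can be obtained as follows. (1) Renumber the integers of $\pi$ as necessary by positive integers, preserving relative order, and insert any number of $*$'s anywhere; call the result $\rho^{(1)}$. (2) Choose a substring $a$ of $\rho^{(1)}$ that is a copy of $\alpha$, and a string $b$ of distinct positive integers and $*$'s such that: $b$ is a copy of $\beta$; all (integer) elements common to $b$ and $\rho^{(1)}$ are contained in $a$; and for every integer $x$ occurring in both $\alpha$ and $\beta$, if $y$ is the integer in $a$ at the same position as $x$ in $\alpha$, then $y$ is in $b$ at the same position as $x$ in $\beta$. Replace $a$ by $b$ in $\rho^{(1)}$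 (position by position). (3) Delete all $*$'s and renumber, preserving relative order, to get the permutation $\sigma$. Elements involved need not be adjacent in position or value, and the length may change. Equivalence. Two permutations (possibly of different lengths) are equivalent under $\alpha\leftrightarrow\beta$ if one can be obtained from the other by a finite (possibly empty) sequence of $\alpha\to\beta$ and $\beta\to\alpha$ replacements. This partitions the set of all permutations $S_0\cup S_1\cup S_2\cup\cdots$ into equivalence classes. *)

theory Defs
  imports "HOL-Combinatorics.Multiset_Permutations"
begin

definition perms :: "nat list set" where
  "perms = (\<Union>n::nat. permutations_of_set {1..n})"

datatype symb = Star | Num nat

fun ints :: "symb list \<Rightarrow> nat list" where
  "ints [] = []"
| "ints (Star # s) = ints s"
| "ints (Num x # s) = x # ints s"

definition star_string :: "symb list \<Rightarrow> bool" where
  "star_string s \<longleftrightarrow> distinct (ints s) \<and> (\<forall>x \<in> set (ints s). x > 0)"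

definition order_iso :: "nat list \<Rightarrow> nat list \<Rightarrow> bool" where
  "order_iso xs ys \<longleftrightarrow> length xs = length ys \<and>
     (\<forall>i < length xs. \<forall>j < length xs. xs ! i < xs ! j \<longleftrightarrow> ys ! i < ys ! j)"

definition is_copy :: "symb list \<Rightarrow> symb list \<Rightarrow> bool" where
  "is_copy r \<delta> \<longleftrightarrow> length r = length \<delta> \<and>
     (\<forall>i < length \<delta>. r ! i = Star \<longleftrightarrow> \<delta> ! i = Star) \<and>
     order_iso (ints r) (ints \<delta>)"

text \<open>
  In \<open>replacement \<alpha> \<beta> \<pi> \<sigma>\<close>, the string \<open>\<rho>\<close> is a renumbering of \<open>\<pi>\<close> with stars inserted.
  A substring of \<open>\<rho>\<close> is given by its set \<open>I\<close> of positions, so that \<open>a = nths \<rho> I\<close>; the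
  string \<open>\<rho>'\<close> is \<open>\<rho>\<close> with the substring at the positions \<open>I\<close> overwritten by \<open>b\<close>. Gaps
  between the integers of \<open>\<rho>\<close> leave room for new integers of \<open>b\<close>.
\<close>

definition replacement ::
  "symb list \<Rightarrow> symb list \<Rightarrow> nat list \<Rightarrow> nat list \<Rightarrow> bool" where
  "replacement \<alpha> \<beta> \<pi> \<sigma> \<longleftrightarrow> \<pi> \<in> perms \<and> \<sigma> \<in> perms \<and>
     (\<exists>\<rho> I a b \<rho>'.
        star_string \<rho> \<and> order_iso (ints \<rho>) \<pi> \<and>
        I \<subseteq> {..<length \<rho>} \<and> a = nths \<rho> I \<and> is_copy a \<alpha> \<and>
        star_string b \<and> is_copy b \<beta> \<and>
        set (ints b) \<inter> set (ints \<rho>) \<subseteq> set (ints a) \<and>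
        (\<forall>x. \<forall>i < length \<alpha>. \<forall>j < length \<beta>.
           \<alpha> ! i = Num x \<and> \<beta> ! j = Num x \<longrightarrow> b ! j = a ! i) \<and>
        length \<rho>' = length \<rho> \<and> nths \<rho>' I = b \<and>
        (\<forall>i < length \<rho>. i \<notin> I \<longrightarrow> \<rho>' ! i = \<rho> ! i) \<and>
        order_iso (ints \<rho>') \<sigma>)"

definition equiv_under :: "symb list \<Rightarrow> symb list \<Rightarrow> (nat list \<times> nat list) set" where
  "equiv_under \<alpha> \<beta> =
     {(\<pi>, \<sigma>). \<pi> \<in> perms \<and> \<sigma> \<in> perms \<and>
        (\<lambda>\<tau> \<tau>'. replacement \<alpha> \<beta> \<tau> \<tau>' \<or> replacement \<beta> \<alpha> \<tau> \<tau>')\<^sup>*\<^sup>* \<pi> \<sigma>}"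

end

theory Submission
  imports Defs "HOL-Library.Sublist"
begin

text \<open>
  Replacing a \<open>123\<close> by a starred decreasing pair deletes one entry of the permutation and leaves
  an inversion. So neither side of a replacement is \<open>\<emptyset>\<close>, \<open>1\<close> or \<open>12\<close>, and \<open>123\<close> and \<open>21\<close> can
  only be exchanged for each other (\<open>replacement_shape\<close>). These four classes are therefore closed,
  and the point is that everything else hangs together.

  The reason is that a replacement does not see the letters that it does not touch. Appending a
  letter to a permutation \<open>\<tau>\<close> does not destroy any replacement \<open>\<tau> \<rightarrow> \<tau>'\<close>: the letter is carried
  along and ends up behind \<open>\<tau>'\<close>, at some relative height (\<open>replacement_snoc\<close>). Hence equivalence,
  too, lifts from the first \<open>n\<close> letters of a permutation to the whole permutation
  (\<open>equiv_under_snoc\<close>).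

  Suppose now that all permutations of length \<open>n \<ge> 3\<close> other than \<open>123\<close> are equivalent to one
  fixed permutation \<open>s\<close> of length 3, the hub. A permutation of length \<open>n + 1\<close> whose first \<open>n\<close>
  letters are not ordered like \<open>123\<close> is then equivalent to a permutation of length 4 whose first
  three letters are ordered like \<open>s\<close>; otherwise it has length 4 itself. So only finitely many
  permutations are left to join to the hub: those of length 3 other than \<open>123\<close>, and the eight
  permutations of length 4 that begin like \<open>123\<close> or like \<open>s\<close> (\<open>hub_walk_imp_long_equiv\<close>). For
  each of the nine patterns this is done by an explicit walk through permutations of length at
  most 5 that visits all of them (\<open>hub_walk\<close>). The detours through length 5 are there because
  a permutation without an increasing triple has to grow before it can shrink.

  Since replacements are reversible (\<open>replacement_sym\<close>), each step of a walk can be described by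
  the direction that deletes an entry, where the result is a simple computation (\<open>contraction\<close>).
\<close>

section \<open>Words, standardization and permutations\<close>

lemma ints_append [simp]: "ints (s @ t) = ints s @ ints t"
  by (induction s rule: ints.induct) auto

lemma subseq_ints: "subseq s t \<Longrightarrow> subseq (ints s) (ints t)"
proof (induction rule: list_emb.induct)
  case (list_emb_Cons s t y)
  then show ?case by (cases y) auto
next
  case (list_emb_Cons2 x y s t)
  then show ?case by (cases y) auto
qed simp

lemma subseq_ints_nths: "subseq (ints (nths s I)) (ints s)"
  by (metis subseq_conv_nths subseq_ints)

lemma mset_ints_nths:
  "mset (ints s) = mset (ints (nths s I) @ ints (nths s (- I)))"
proof (induction s arbitrary: I)
  case (Cons c s)
  have "{j. Suc j \<in> - I} = - {j. Suc j \<in> I}" by auto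
  then show ?case using Cons[of "{j. Suc j \<in> I}"]
    by (cases c) (auto simp: nths_Cons)
qed simp

lemma nths_cong:
  assumes "length xs = length ys" "\<And>i. i < length xs \<Longrightarrow> i \<in> J \<Longrightarrow> xs ! i = ys ! i"
  shows "nths xs J = nths ys J"
  using assms
proof (induction xs ys arbitrary: J rule: list_induct2)
  case (Cons x xs y ys)
  have "nths xs {j. Suc j \<in> J} = nths ys {j. Suc j \<in> J}"
    using Cons.prems[of "Suc _"] by (intro Cons.IH) auto
  moreover have "0 \<in> J \<Longrightarrow> x = y" using Cons.prems[of 0] by simp
  ultimately show ?case by (auto simp: nths_Cons)
qed simp

lemma order_iso_refl [simp]: "order_iso w w"
  by (simp add: order_iso_def)

lemma order_iso_sym: "order_iso v w \<Longrightarrow> order_iso w v"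
  by (simp add: order_iso_def)

lemma order_iso_trans: "order_iso u v \<Longrightarrow> order_iso v w \<Longrightarrow> order_iso u w"
  by (simp add: order_iso_def)

lemma order_iso_snoc:
  assumes "order_iso v w"
    and "\<And>i. i < length v \<Longrightarrow> v ! i < x \<longleftrightarrow> w ! i < y"
    and "\<And>i. i < length v \<Longrightarrow> x < v ! i \<longleftrightarrow> y < w ! i"
  shows "order_iso (v @ [x]) (w @ [y])"
  using assms unfolding order_iso_def by (auto simp: nth_append less_Suc_eq)

lemma order_iso_snocD:
  assumes "order_iso (v @ [x]) (w @ [y])"
  shows "order_iso v w"
  unfolding order_iso_def
proof (intro conjI allI impI)
  show len: "length v = length w" using assms by (simp add: order_iso_def)
  fix i j assume "i < length v" "j < length v"
  moreover have "(v @ [x]) ! i < (v @ [x]) ! j \<longleftrightarrow> (w @ [y]) ! i < (w @ [y]) ! j"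
    using assms \<open>i < length v\<close> \<open>j < length v\<close> unfolding order_iso_def by simp
  ultimately show "v ! i < v ! j \<longleftrightarrow> w ! i < w ! j" using len by (simp add: nth_append)
qed

definition standardize :: "nat list \<Rightarrow> nat list" where
  "standardize w = map (\<lambda>x. length (filter (\<lambda>y. y \<le> x) w)) w"

lemma length_standardize [simp]: "length (standardize w) = length w"
  by (simp add: standardize_def)

lemma length_filter_le_mono:
  "x \<le> y \<Longrightarrow> length (filter (\<lambda>z. z \<le> x) w) \<le> length (filter (\<lambda>z. z \<le> (y::nat)) w)"
  by (induction w) auto

lemma length_filter_le_strict_mono:
  assumes "y \<in> set w"  "x < y"
  shows "length (filter (\<lambda>z. z \<le> x) w) < length (filter (\<lambda>z. z \<le> (y::nat)) w)"
  using assms(1)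
proof (induction w)
  case (Cons a w)
  show ?case
  proof (cases "a = y")
    case True
    then show ?thesis using length_filter_le_mono[of x y w] assms(2) by simp
  next
    case False
    then show ?thesis using Cons assms(2) by simp
  qed
qed simp

lemma standardize_less_iff:
  assumes "x \<in> set w" "y \<in> set w"
  shows "length (filter (\<lambda>z. z \<le> x) w) < length (filter (\<lambda>z. z \<le> (y::nat)) w) \<longleftrightarrow> x < y"
  using length_filter_le_strict_mono[of y w x] length_filter_le_mono[of y x w] assms
  by (meson linorder_not_le)

lemma order_iso_standardize: "order_iso w (standardize w)"
  by (simp add: order_iso_def standardize_def standardize_less_iff)

text \<open>
  Ranks depend only on the comparisons between entries, so standardization turns order isomorphism
  into equality.
\<close>

lemma order_iso_imp_standardize_eq:
  assumes "order_iso v w"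
  shows "standardize v = standardize w"
proof (rule nth_equalityI)
  fix i assume i: "i < length (standardize v)"
  have len: "length v = length w" using assms by (simp add: order_iso_def)
  have "{j. j < length v \<and> v ! j \<le> v ! i} = {j. j < length w \<and> w ! j \<le> w ! i}"
    using assms i unfolding order_iso_def by (auto simp flip: linorder_not_less)
  then show "standardize v ! i = standardize w ! i"
    using i len by (simp add: standardize_def length_filter_conv_card)
qed (use assms in \<open>simp add: order_iso_def\<close>)

lemma standardize_eq_iff_order_iso: "standardize v = standardize w \<longleftrightarrow> order_iso v w"
proof
  assume "standardize v = standardize w"
  then have "order_iso v (standardize w)" using order_iso_standardize[of v] by simp
  then show "order_iso v w" using order_iso_standardize order_iso_sym order_iso_trans by blast
qed (rule order_iso_imp_standardize_eq)

lemma perms_iff: "p \<in> perms \<longleftrightarrow> distinct p \<and> set p = {1..length p}"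
proof
  assume "p \<in> perms"
  then obtain n where n: "distinct p" "set p = {1..n}"
    by (auto simp: perms_def permutations_of_set_def)
  then have "length p = n" using distinct_card[of p] by simp
  then show "distinct p \<and> set p = {1..length p}" using n by simp
next
  assume "distinct p \<and> set p = {1..length p}"
  then have "p \<in> permutations_of_set {1..length p}" by (simp add: permutations_of_set_def)
  then show "p \<in> perms" unfolding perms_def by blast
qed

lemma standardize_in_perms:
  assumes "distinct w"
  shows "standardize w \<in> perms"
proof -
  have "inj_on (\<lambda>x. length (filter (\<lambda>y. y \<le> x) w)) (set w)"
    by (rule linorder_inj_onI') (use standardize_less_iff in fastforce)
  then have d: "distinct (standardize w)" using assms by (simp add: standardize_def distinct_map)
  have "0 < length (filter (\<lambda>y. y \<le> x) w)" if "x \<in> set w" for x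
    using that by (auto simp: filter_empty_conv)
  then have "set (standardize w) \<subseteq> {1..length w}"
    by (auto simp: standardize_def Suc_le_eq)
  moreover have "card (set (standardize w)) = length w" using distinct_card[OF d] by simp
  ultimately have "set (standardize w) = {1..length w}" by (intro card_subset_eq) auto
  with d show ?thesis by (simp add: perms_iff)
qed

lemma standardize_perm:
  assumes "p \<in> perms"
  shows "standardize p = p"
proof -
  have "length (filter (\<lambda>y. y \<le> x) p) = x" if "x \<in> set p" for x
  proof -
    have "length (filter (\<lambda>y. y \<le> x) p) = card (set (filter (\<lambda>y. y \<le> x) p))"
      using assms by (intro distinct_card[symmetric] distinct_filter) (simp add: perms_iff)
    also have "set (filter (\<lambda>y. y \<le> x) p) = {1..x}"
      using assms that by (auto simp: perms_iff)
    finally show ?thesis by simp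
  qed
  then show ?thesis unfolding standardize_def by (intro map_idI) auto
qed

section \<open>Replacements as overwritten strings\<close>

text \<open>
  Both strings consist of what is written at the positions in \<open>I\<close> and of the same remainder \<open>R\<close>,
  up to order. Everything below about lengths and distinctness follows from this count.
\<close>

lemma mset_overwrite:
  assumes "length \<rho>' = length \<rho>" "\<forall>i < length \<rho>. i \<notin> I \<longrightarrow> \<rho>' ! i = \<rho> ! i"
  obtains R where
    "mset (ints \<rho>) = mset (ints (nths \<rho> I) @ R)" "mset (ints \<rho>') = mset (ints (nths \<rho>' I) @ R)"
proof -
  have "nths \<rho>' (- I) = nths \<rho> (- I)"
    using assms by (intro nths_cong) auto
  then show ?thesis
    using that mset_ints_nths[of \<rho> I] mset_ints_nths[of \<rho>' I] by simp
qed

text \<open>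
  The condition that new entries be fresh says no more and no less than that overwriting yields a
  string of distinct entries again.
\<close>

lemma star_string_overwrite_iff:
  assumes "star_string \<rho>" "length \<rho>' = length \<rho>" "\<forall>i < length \<rho>. i \<notin> I \<longrightarrow> \<rho>' ! i = \<rho> ! i"
  shows "star_string \<rho>' \<longleftrightarrow> star_string (nths \<rho>' I) \<and>
      set (ints (nths \<rho>' I)) \<inter> set (ints \<rho>) \<subseteq> set (ints (nths \<rho> I))"
proof -
  obtain R where m: "mset (ints \<rho>) = mset (ints (nths \<rho> I) @ R)"
    "mset (ints \<rho>') = mset (ints (nths \<rho>' I) @ R)"
    using mset_overwrite[OF assms(2,3)] .
  show ?thesis
    using assms(1) mset_eq_imp_distinct_iff[OF m(1)] mset_eq_imp_distinct_iff[OF m(2)]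
      mset_eq_setD[OF m(1)] mset_eq_setD[OF m(2)]
    unfolding star_string_def by auto
qed

text \<open>
  The core of a replacement, on strings instead of permutations. Requiring \<open>\<rho>'\<close> to be a star string
  takes the place of the freshness condition and makes the roles of the two sides symmetric.
\<close>

definition overwrite :: "symb list \<Rightarrow> symb list \<Rightarrow> symb list \<Rightarrow> symb list \<Rightarrow> bool" where
  "overwrite \<alpha> \<beta> \<rho> \<rho>' \<longleftrightarrow> star_string \<rho> \<and> star_string \<rho>' \<and> length \<rho>' = length \<rho> \<and>
     (\<exists>I \<subseteq> {..<length \<rho>}.
        is_copy (nths \<rho> I) \<alpha> \<and> is_copy (nths \<rho>' I) \<beta> \<and>
        (\<forall>i < length \<rho>. i \<notin> I \<longrightarrow> \<rho>' ! i = \<rho> ! i) \<and>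
        (\<forall>x. \<forall>i < length \<alpha>. \<forall>j < length \<beta>.
           \<alpha> ! i = Num x \<and> \<beta> ! j = Num x \<longrightarrow> nths \<rho>' I ! j = nths \<rho> I ! i))"

lemma overwrite_sym: "overwrite \<alpha> \<beta> \<rho> \<rho>' \<Longrightarrow> overwrite \<beta> \<alpha> \<rho>' \<rho>"
  unfolding overwrite_def by metis

lemma replacement_iff_overwrite:
  "replacement \<alpha> \<beta> \<pi> \<sigma> \<longleftrightarrow> \<pi> \<in> perms \<and> \<sigma> \<in> perms \<and>
     (\<exists>\<rho> \<rho>'. overwrite \<alpha> \<beta> \<rho> \<rho>' \<and> order_iso (ints \<rho>) \<pi> \<and> order_iso (ints \<rho>') \<sigma>)"
  (is "?L \<longleftrightarrow> ?R")
proof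
  assume ?L
  then obtain \<rho> I \<rho>' where *: "\<pi> \<in> perms" "\<sigma> \<in> perms" "star_string \<rho>" "order_iso (ints \<rho>) \<pi>"
    "I \<subseteq> {..<length \<rho>}" "is_copy (nths \<rho> I) \<alpha>" "star_string (nths \<rho>' I)" "is_copy (nths \<rho>' I) \<beta>"
    "set (ints (nths \<rho>' I)) \<inter> set (ints \<rho>) \<subseteq> set (ints (nths \<rho> I))"
    "\<forall>x. \<forall>i < length \<alpha>. \<forall>j < length \<beta>.
       \<alpha> ! i = Num x \<and> \<beta> ! j = Num x \<longrightarrow> nths \<rho>' I ! j = nths \<rho> I ! i"
    "length \<rho>' = length \<rho>" "\<forall>i < length \<rho>. i \<notin> I \<longrightarrow> \<rho>' ! i = \<rho> ! i" "order_iso (ints \<rho>') \<sigma>"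
    unfolding replacement_def by blast
  then have "overwrite \<alpha> \<beta> \<rho> \<rho>'"
    using star_string_overwrite_iff[of \<rho> \<rho>' I] unfolding overwrite_def by blast
  with * show ?R by blast
next
  assume ?R
  then obtain \<rho> \<rho>' where *: "\<pi> \<in> perms" "\<sigma> \<in> perms" "overwrite \<alpha> \<beta> \<rho> \<rho>'"
    "order_iso (ints \<rho>) \<pi>" "order_iso (ints \<rho>') \<sigma>" by blast
  then obtain I where I: "star_string \<rho>" "star_string \<rho>'" "length \<rho>' = length \<rho>"
    "I \<subseteq> {..<length \<rho>}" "is_copy (nths \<rho> I) \<alpha>" "is_copy (nths \<rho>' I) \<beta>"
    "\<forall>i < length \<rho>. i \<notin> I \<longrightarrow> \<rho>' ! i = \<rho> ! i"
    "\<forall>x. \<forall>i < length \<alpha>. \<forall>j < length \<beta>.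
       \<alpha> ! i = Num x \<and> \<beta> ! j = Num x \<longrightarrow> nths \<rho>' I ! j = nths \<rho> I ! i"
    unfolding overwrite_def by blast
  then show ?L
    using * star_string_overwrite_iff[of \<rho> \<rho>' I] unfolding replacement_def by blast
qed

lemma replacement_sym: "replacement \<alpha> \<beta> \<pi> \<sigma> \<Longrightarrow> replacement \<beta> \<alpha> \<sigma> \<pi>"
  unfolding replacement_iff_overwrite using overwrite_sym by blast

section \<open>Replacements survive an appended letter\<close>

fun relabel :: "(nat \<Rightarrow> nat) \<Rightarrow> symb \<Rightarrow> symb" where
  "relabel f Star = Star"
| "relabel f (Num m) = Num (f m)"

lemma relabel_eq_Star [simp]: "relabel f s = Star \<longleftrightarrow> s = Star"
  by (cases s) auto

lemma ints_relabel [simp]: "ints (map (relabel f) s) = map f (ints s)"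
  by (induction s rule: ints.induct) auto

lemma is_copy_relabel:
  assumes "strict_mono_on (set (ints s)) f" "is_copy s \<delta>"
  shows "is_copy (map (relabel f) s) \<delta>"
proof -
  have "order_iso (map f (ints s)) (ints s)"
    using assms(1) by (simp add: order_iso_def strict_mono_on_less)
  then show ?thesis using assms(2) order_iso_trans[of "map f (ints s)" "ints s" "ints \<delta>"]
    unfolding is_copy_def by simp
qed

text \<open>
  Doubling all entries keeps their order and frees all odd numbers, so that an odd letter can be
  appended at any height without clashing with old or new entries.
\<close>

lemma overwrite_double_snoc:
  assumes "overwrite \<alpha> \<beta> \<rho> \<rho>'" "odd z"
  shows "overwrite \<alpha> \<beta> (map (relabel ((*) 2)) \<rho> @ [Num z]) (map (relabel ((*) 2)) \<rho>' @ [Num z])"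
proof -
  let ?D = "map (relabel ((*) 2))"
  obtain I where I: "star_string \<rho>" "star_string \<rho>'" "length \<rho>' = length \<rho>"
    "I \<subseteq> {..<length \<rho>}" "is_copy (nths \<rho> I) \<alpha>" "is_copy (nths \<rho>' I) \<beta>"
    "\<forall>i < length \<rho>. i \<notin> I \<longrightarrow> \<rho>' ! i = \<rho> ! i"
    "\<forall>x. \<forall>i < length \<alpha>. \<forall>j < length \<beta>.
       \<alpha> ! i = Num x \<and> \<beta> ! j = Num x \<longrightarrow> nths \<rho>' I ! j = nths \<rho> I ! i"
    using assms(1) unfolding overwrite_def by blast
  have star: "star_string (?D s @ [Num z])" if "star_string s" for s
  proof -
    have "z \<notin> (*) 2 ` set (ints s)" using assms(2) by auto
    then show ?thesis using that odd_pos[OF assms(2)]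
      by (auto simp: star_string_def distinct_map inj_on_def)
  qed
  have nths: "nths (?D s @ [Num z]) I = ?D (nths s I)" if "length s = length \<rho>" for s
  proof -
    have "{j. j + length \<rho> \<in> I} = {}" using I(4) by auto
    then show ?thesis using that by (simp add: nths_append nths_map)
  qed
  have copy: "is_copy (?D s) \<delta>" if "is_copy s \<delta>" for s \<delta>
    by (rule is_copy_relabel) (use that in \<open>auto simp: strict_mono_on_def\<close>)
  show ?thesis unfolding overwrite_def
  proof (intro conjI exI[of _ I])
    show "I \<subseteq> {..<length (?D \<rho> @ [Num z])}" using I(4) by auto
    show "\<forall>i<length (?D \<rho> @ [Num z]). i \<notin> I \<longrightarrow> (?D \<rho>' @ [Num z]) ! i = (?D \<rho> @ [Num z]) ! i"
      using I(3,7) by (simp add: nth_append)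
    show "\<forall>x. \<forall>i<length \<alpha>. \<forall>j<length \<beta>. \<alpha> ! i = Num x \<and> \<beta> ! j = Num x \<longrightarrow>
        nths (?D \<rho>' @ [Num z]) I ! j = nths (?D \<rho> @ [Num z]) I ! i"
      using I(3,5,6,8) by (simp add: nths is_copy_def)
  qed (use I in \<open>simp_all add: star nths copy\<close>)
qed

text \<open>
  The appended letter must stand in the same relation to the entries of the string \<open>\<rho>\<close> as \<open>k\<close> does
  to those of \<open>u\<close>. After doubling, the odd number just above all entries that lie below \<open>k\<close> does it.
  Its height relative to \<open>\<tau>'\<close> depends on the new entries, so \<open>k'\<close> is only claimed to exist.
\<close>

lemma replacement_snoc:
  assumes repl: "replacement \<alpha> \<beta> \<tau> \<tau>'" and perm: "u @ [k] \<in> perms" and u: "standardize u = \<tau>"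
  shows "\<exists>u' k'. u' @ [k'] \<in> perms \<and> standardize u' = \<tau>' \<and> replacement \<alpha> \<beta> (u @ [k]) (u' @ [k'])"
proof -
  obtain \<rho> \<rho>' where *: "\<tau> \<in> perms" "\<tau>' \<in> perms" "overwrite \<alpha> \<beta> \<rho> \<rho>'"
    "order_iso (ints \<rho>) \<tau>" "order_iso (ints \<rho>') \<tau>'"
    using repl unfolding replacement_iff_overwrite by blast
  have \<rho>: "star_string \<rho>" "star_string \<rho>'" using *(3) by (simp_all add: overwrite_def)
  define P where "P = ints \<rho>"
  have Pu: "order_iso P u"
    using *(1,4) u unfolding P_def by (simp add: standardize_perm flip: standardize_eq_iff_order_iso)
  have lenP: "length P = length u" using Pu by (simp add: order_iso_def)
  define M where "M = Max (insert 0 {P ! i |i. i < length P \<and> u ! i < k})"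
  define z where "z = Suc (2 * M)"
  have "odd z" by (simp add: z_def)
  have zP: "2 * P ! i < z \<longleftrightarrow> u ! i < k" if i: "i < length P" for i
  proof
    assume "u ! i < k"
    then have "P ! i \<le> M" unfolding M_def using i by (intro Max_ge) auto
    then show "2 * P ! i < z" by (simp add: z_def)
  next
    assume "2 * P ! i < z"
    then have le: "P ! i \<le> M" by (simp add: z_def)
    \<comment> \<open>Positive entries cannot be confused with the default 0 of the maximum.\<close>
    have "P ! i > 0" using \<rho>(1) i unfolding star_string_def P_def by simp
    moreover have "M \<in> insert 0 {P ! i |i. i < length P \<and> u ! i < k}"
      unfolding M_def by (intro Max_in) auto
    ultimately obtain j where j: "j < length P" "u ! j < k" "M = P ! j" using le by auto
    then have "P ! j < P ! i \<longleftrightarrow> u ! j < u ! i" using Pu i unfolding order_iso_def by blast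
    then show "u ! i < k" using j le by simp
  qed
  have iso: "order_iso (map ((*) 2) P @ [z]) (u @ [k])"
  proof (rule order_iso_snoc)
    show "order_iso (map ((*) 2) P) u" using Pu by (simp add: order_iso_def)
    fix i assume i: "i < length (map ((*) 2) P)"
    have "2 * P ! i \<noteq> z" unfolding z_def by presburger
    moreover have "u ! i \<noteq> k"
      using perm i lenP by (auto simp: perms_iff)
    ultimately show "map ((*) 2) P ! i < z \<longleftrightarrow> u ! i < k" "z < map ((*) 2) P ! i \<longleftrightarrow> k < u ! i"
      using zP[of i] i by auto
  qed
  let ?D = "map (relabel ((*) 2))"
  have ow: "overwrite \<alpha> \<beta> (?D \<rho> @ [Num z]) (?D \<rho>' @ [Num z])"
    using overwrite_double_snoc[OF *(3) \<open>odd z\<close>] .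
  define \<sigma> where "\<sigma> = standardize (map ((*) 2) (ints \<rho>') @ [z])"
  have \<sigma>: "\<sigma> \<in> perms" unfolding \<sigma>_def
    using ow by (intro standardize_in_perms) (simp add: overwrite_def star_string_def)
  have o\<sigma>: "order_iso (map ((*) 2) (ints \<rho>') @ [z]) \<sigma>" unfolding \<sigma>_def by (rule order_iso_standardize)
  have "\<sigma> \<noteq> []" using o\<sigma> by (auto simp: order_iso_def)
  then obtain u' k' where \<sigma>_eq: "\<sigma> = u' @ [k']" by (meson rev_exhaust)
  have "order_iso (map ((*) 2) (ints \<rho>')) u'"
    using o\<sigma> order_iso_snocD unfolding \<sigma>_eq by blast
  then have "order_iso (ints \<rho>') u'" by (simp add: order_iso_def)
  then have "standardize u' = \<tau>'"
    using *(2,5) by (simp add: standardize_perm flip: standardize_eq_iff_order_iso)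
  moreover have "replacement \<alpha> \<beta> (u @ [k]) \<sigma>"
    unfolding replacement_iff_overwrite using perm \<sigma> ow iso o\<sigma>
    by (intro conjI exI[of _ "?D \<rho> @ [Num z]"] exI[of _ "?D \<rho>' @ [Num z]"]) (auto simp: P_def)
  ultimately show ?thesis using \<sigma> \<sigma>_eq by blast
qed


section \<open>Replacing a rise by a decreasing pair\<close>

lemma nths_three:
  assumes "i < j" "j < k" "k < length xs"
  shows "nths xs {i, j, k} = [xs ! i, xs ! j, xs ! k]"
proof -
  have "nths xs I = map ((!) xs) (filter (\<lambda>i. i \<in> I) [0..<length xs])" for I
    by (induction xs rule: rev_induct) (auto simp: nths_append nth_append cong: filter_cong map_cong)
  moreover have "filter (\<lambda>l. l \<in> {i, j, k}) [0..<length xs] = [i, j, k]"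
    using assms by (intro sorted_distinct_set_unique) (auto intro: sorted_wrt_filter)
  ultimately show ?thesis by simp
qed

definition decreasing_pair :: "symb list \<Rightarrow> bool" where
  "decreasing_pair \<beta> \<longleftrightarrow> length \<beta> = 3 \<and> (\<exists>c d. ints \<beta> = [c, d] \<and> d < c \<and> {c, d} \<subseteq> {1, 2, 3})"

abbreviation (input) "rise \<equiv> [Num 1, Num 2, Num 3]"

text \<open>
  The letters \<open>1, 2, 3\<close> of \<open>\<beta>\<close> stand for the three entries at the positions \<open>i, j, k\<close>. As \<open>\<beta>\<close> has
  no other letters, the permutation itself can serve as the string that is overwritten, and
  standardization closes the gap left by the deleted entry.
\<close>

definition contraction :: "symb list \<Rightarrow> nat list \<Rightarrow> nat \<Rightarrow> nat \<Rightarrow> nat \<Rightarrow> nat list" where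
  "contraction \<beta> \<pi> i j k =
     (let b = map (relabel (\<lambda>m. [\<pi> ! i, \<pi> ! j, \<pi> ! k] ! (m - 1))) \<beta>
      in standardize (ints ((map Num \<pi>)[i := b ! 0, j := b ! 1, k := b ! 2])))"

definition contracts_to :: "symb list \<Rightarrow> nat list \<Rightarrow> nat list \<Rightarrow> bool" where
  "contracts_to \<beta> \<pi> \<sigma> \<longleftrightarrow>
     (\<exists>k \<in> {..<length \<pi>}. \<exists>j \<in> {..<k}. \<exists>i \<in> {..<j}.
        \<pi> ! i < \<pi> ! j \<and> \<pi> ! j < \<pi> ! k \<and> contraction \<beta> \<pi> i j k = \<sigma>)"

lemma ints_map_Num [simp]: "ints (map Num w) = w"
  by (induction w) auto

lemma contracts_to_imp_replacement:
  assumes "contracts_to \<beta> \<pi> \<sigma>" and \<pi>: "\<pi> \<in> perms" and \<beta>: "decreasing_pair \<beta>"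
  shows "replacement rise \<beta> \<pi> \<sigma>"
proof -
  obtain i j k where ijk: "i < j" "j < k" "k < length \<pi>" "\<pi> ! i < \<pi> ! j" "\<pi> ! j < \<pi> ! k"
    and \<sigma>: "\<sigma> = contraction \<beta> \<pi> i j k"
    using assms(1) by (auto simp: contracts_to_def)
  define f where "f = (\<lambda>m. [\<pi> ! i, \<pi> ! j, \<pi> ! k] ! (m - 1))"
  define b where "b = map (relabel f) \<beta>"
  define \<rho>' where "\<rho>' = (map Num \<pi>)[i := b ! 0, j := b ! 1, k := b ! 2]"
  let ?\<rho> = "map Num \<pi>" and ?I = "{i, j, k}"
  have f: "f 1 = \<pi> ! i" "f 2 = \<pi> ! j" "f 3 = \<pi> ! k" by (simp_all add: f_def)
  have mono: "strict_mono_on {1, 2, 3} f"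
    using ijk f by (auto simp: strict_mono_on_def)
  have len\<beta>: "length \<beta> = 3" and \<beta>_sub: "set (ints \<beta>) \<subseteq> {1, 2, 3}" and \<beta>_dist: "distinct (ints \<beta>)"
    using \<beta> by (auto simp: decreasing_pair_def)
  have star: "star_string ?\<rho>" using \<pi> by (simp add: star_string_def perms_iff)
  have a: "nths ?\<rho> ?I = [Num (\<pi> ! i), Num (\<pi> ! j), Num (\<pi> ! k)]"
    using nths_three[of i j k ?\<rho>] ijk by simp
  have "length b = 3" using len\<beta> by (simp add: b_def)
  then have "b = [b ! 0, b ! 1, b ! 2]"
    by (intro nth_equalityI) (auto simp: less_Suc_eq numeral_3_eq_3 numeral_2_eq_2)
  moreover have "nths \<rho>' ?I = [\<rho>' ! i, \<rho>' ! j, \<rho>' ! k]"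
    using ijk by (intro nths_three) (simp_all add: \<rho>'_def)
  ultimately have b: "nths \<rho>' ?I = b"
    using ijk by (simp add: \<rho>'_def)
  have len: "length \<rho>' = length ?\<rho>" by (simp add: \<rho>'_def)
  have outside: "\<forall>l < length ?\<rho>. l \<notin> ?I \<longrightarrow> \<rho>' ! l = ?\<rho> ! l" by (simp add: \<rho>'_def)
  have b_sub: "set (ints b) \<subseteq> {\<pi> ! i, \<pi> ! j, \<pi> ! k}"
    using \<beta>_sub f by (auto simp: b_def)
  have "inj_on f (set (ints \<beta>))"
    using mono \<beta>_sub by (meson inj_on_subset strict_mono_on_imp_inj_on)
  moreover have "{\<pi> ! i, \<pi> ! j, \<pi> ! k} \<subseteq> set \<pi>" using ijk by auto
  ultimately have "star_string b"
    using \<beta>_dist b_sub \<pi> by (auto simp: star_string_def b_def distinct_map perms_iff)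
  then have star': "star_string \<rho>'"
    using star_string_overwrite_iff[OF star len outside] a b b_sub by auto
  have "overwrite rise \<beta> ?\<rho> \<rho>'"
    unfolding overwrite_def
  proof (intro conjI exI[of _ ?I])
    show "?I \<subseteq> {..<length ?\<rho>}" using ijk by auto
    show "is_copy (nths ?\<rho> ?I) rise"
      using ijk unfolding a by (auto simp: is_copy_def order_iso_def less_Suc_eq numeral_3_eq_3)
    have "is_copy \<beta> \<beta>" by (simp add: is_copy_def)
    then show "is_copy (nths \<rho>' ?I) \<beta>"
      unfolding b b_def using mono \<beta>_sub
      by (intro is_copy_relabel) (meson monotone_on_subset)
    show "\<forall>x. \<forall>i' < length rise. \<forall>j' < length \<beta>. rise ! i' = Num x \<and> \<beta> ! j' = Num x \<longrightarrow>
        nths \<rho>' ?I ! j' = nths ?\<rho> ?I ! i'"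
      unfolding a b using f
      by (auto simp: b_def less_Suc_eq numeral_3_eq_3 numeral_2_eq_2)
  qed (use star star' len outside in auto)
  moreover have "\<sigma> = standardize (ints \<rho>')"
    unfolding \<sigma> contraction_def \<rho>'_def b_def f_def Let_def ..
  moreover have "standardize (ints \<rho>') \<in> perms" using star' by (intro standardize_in_perms) (simp add: star_string_def)
  ultimately show ?thesis
    unfolding replacement_iff_overwrite using \<pi> order_iso_standardize
    by (intro conjI exI[of _ ?\<rho>] exI[of _ \<rho>']) auto
qed

text \<open>
  The pattern \<open>123\<close> has one integer more than \<open>\<beta>\<close>, which gives the lengths. The integers of \<open>\<beta>\<close> are
  decreasing, and they are copied into \<open>\<sigma>\<close>, so \<open>\<sigma>\<close> has an inversion. If a side is as short as its
  pattern, then the copy of the pattern is all of it.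
\<close>

lemma replacement_shape:
  assumes repl: "replacement rise \<beta> \<pi> \<sigma>" and \<beta>: "decreasing_pair \<beta>"
  shows "3 \<le> length \<pi>" "length \<pi> = Suc (length \<sigma>)" "\<not> sorted \<sigma>"
    "length \<pi> = 3 \<Longrightarrow> \<pi> = [1, 2, 3]" "length \<sigma> = 2 \<Longrightarrow> \<sigma> = [2, 1]"
proof -
  obtain \<rho> \<rho>' I where *: "\<pi> \<in> perms" "\<sigma> \<in> perms" "order_iso (ints \<rho>) \<pi>" "order_iso (ints \<rho>') \<sigma>"
    "length \<rho>' = length \<rho>" "\<forall>i < length \<rho>. i \<notin> I \<longrightarrow> \<rho>' ! i = \<rho> ! i"
    "is_copy (nths \<rho> I) rise" "is_copy (nths \<rho>' I) \<beta>"
    using repl unfolding replacement_iff_overwrite overwrite_def by blast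
  obtain c d where cd: "ints \<beta> = [c, d]" "d < c" using \<beta> by (auto simp: decreasing_pair_def)
  have A: "order_iso (ints (nths \<rho> I)) [1, 2, 3]" and B: "order_iso (ints (nths \<rho>' I)) [c, d]"
    using *(7,8) cd by (simp_all add: is_copy_def)
  have lenA: "length (ints (nths \<rho> I)) = 3" and lenB: "length (ints (nths \<rho>' I)) = 2"
    using A B by (simp_all add: order_iso_def)
  have len: "length \<pi> = length (ints \<rho>)" "length \<sigma> = length (ints \<rho>')"
    using *(3,4) by (simp_all add: order_iso_def)
  obtain R where m: "mset (ints \<rho>) = mset (ints (nths \<rho> I) @ R)"
    "mset (ints \<rho>') = mset (ints (nths \<rho>' I) @ R)"
    using mset_overwrite[OF *(5,6)] .
  show "3 \<le> length \<pi>" "length \<pi> = Suc (length \<sigma>)"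
    using len lenA lenB mset_eq_length[OF m(1)] mset_eq_length[OF m(2)] by simp_all
  show "\<not> sorted \<sigma>"
  proof
    assume "sorted \<sigma>"
    then have "sorted (ints \<rho>')"
      using *(4) unfolding sorted_iff_nth_mono order_iso_def by (simp flip: linorder_not_less)
    then have "sorted (ints (nths \<rho>' I))"
      using subseq_ints_nths[of \<rho>' I] by (metis sorted_nths subseq_conv_nths)
    then have "\<not> ints (nths \<rho>' I) ! 1 < ints (nths \<rho>' I) ! 0"
      using lenB by (simp add: sorted_iff_nth_mono linorder_not_less)
    moreover have "ints (nths \<rho>' I) ! 1 < ints (nths \<rho>' I) ! 0 \<longleftrightarrow> [c, d] ! 1 < [c, d] ! 0"
      using B unfolding order_iso_def lenB by simp
    ultimately show False using cd by simp
  qed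
  have whole: "ints (nths s I) = ints s" if "length (ints (nths s I)) = length (ints s)" for s
    using subseq_same_length[OF subseq_ints_nths that] .
  show "\<pi> = [1, 2, 3]" if "length \<pi> = 3"
  proof -
    have "standardize \<pi> = standardize [1, 2, 3]"
      using A *(3) whole[of \<rho>] that len lenA by (simp flip: standardize_eq_iff_order_iso)
    then show ?thesis using standardize_perm[OF *(1)] by (simp add: standardize_def numeral_eq_Suc)
  qed
  show "\<sigma> = [2, 1]" if "length \<sigma> = 2"
  proof -
    have "standardize \<sigma> = standardize [c, d]"
      using B *(4) whole[of \<rho>'] that len lenB by (simp flip: standardize_eq_iff_order_iso)
    then show ?thesis using standardize_perm[OF *(2)] cd by (simp add: standardize_def numeral_eq_Suc)
  qed
qed

section \<open>All long permutations are equivalent\<close>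

lemma equiv_equiv_under: "equiv perms (equiv_under \<alpha> \<beta>)"
proof (rule equivI)
  let ?S = "\<lambda>\<tau> \<tau>'. replacement \<alpha> \<beta> \<tau> \<tau>' \<or> replacement \<beta> \<alpha> \<tau> \<tau>'"
  show "equiv_under \<alpha> \<beta> \<subseteq> perms \<times> perms" by (auto simp: equiv_under_def)
  show "refl_on perms (equiv_under \<alpha> \<beta>)"
    by (auto simp: refl_on_def equiv_under_def)
  have "symp ?S" using replacement_sym by (blast intro: sympI)
  then have "symp ?S\<^sup>*\<^sup>*" by (rule symp_rtranclp)
  then show "sym (equiv_under \<alpha> \<beta>)"
    unfolding sym_def equiv_under_def by (auto dest: sympD)
  show "trans (equiv_under \<alpha> \<beta>)"
    unfolding trans_def equiv_under_def by (auto dest: rtranclp_trans)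
qed

lemma replacement_imp_equiv_under:
  "replacement \<alpha> \<beta> \<pi> \<sigma> \<Longrightarrow> (\<pi>, \<sigma>) \<in> equiv_under \<alpha> \<beta>"
  using r_into_rtranclp[of "\<lambda>\<tau> \<tau>'. replacement \<alpha> \<beta> \<tau> \<tau>' \<or> replacement \<beta> \<alpha> \<tau> \<tau>'"]
  by (simp add: equiv_under_def replacement_iff_overwrite)

text \<open>
  A chain of replacements is lifted step by step; the height of the last letter may change in each
  step.
\<close>

lemma equiv_under_snoc:
  assumes "(\<tau>, \<tau>') \<in> equiv_under \<alpha> \<beta>" "u @ [k] \<in> perms" "standardize u = \<tau>"
  shows "\<exists>u' k'. standardize u' = \<tau>' \<and> (u @ [k], u' @ [k']) \<in> equiv_under \<alpha> \<beta>"
proof -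
  let ?S = "\<lambda>\<tau> \<tau>'. replacement \<alpha> \<beta> \<tau> \<tau>' \<or> replacement \<beta> \<alpha> \<tau> \<tau>'"
  have "?S\<^sup>*\<^sup>* \<tau> \<tau>'" using assms(1) by (simp add: equiv_under_def)
  then have "\<exists>u' k'. u' @ [k'] \<in> perms \<and> standardize u' = \<tau>' \<and> (u @ [k], u' @ [k']) \<in> equiv_under \<alpha> \<beta>"
  proof induction
    case base
    then show ?case using assms(2,3) by (auto simp: equiv_under_def)
  next
    case (step \<sigma> \<sigma>')
    then obtain v l where v: "v @ [l] \<in> perms" "standardize v = \<sigma>" "(u @ [k], v @ [l]) \<in> equiv_under \<alpha> \<beta>"
      by blast
    obtain w m where w: "w @ [m] \<in> perms" "standardize w = \<sigma>'" "?S (v @ [l]) (w @ [m])"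
      using step.hyps(2) replacement_snoc[OF _ v(1,2)] by metis
    have "(v @ [l], w @ [m]) \<in> equiv_under \<alpha> \<beta>"
      using w(1,3) v(1) unfolding equiv_under_def by auto
    with v(3) have "(u @ [k], w @ [m]) \<in> equiv_under \<alpha> \<beta>"
      using equiv_equiv_under[of \<alpha> \<beta>] by (meson equivE transD)
    with w(1,2) show ?case by blast
  qed
  then show ?thesis by blast
qed

text \<open>
  A certificate that can be checked by evaluation. The walk may repeat permutations, so it can
  traverse a tree of replacements by going back and forth.
\<close>

definition hub_walk :: "symb list \<Rightarrow> nat list \<Rightarrow> nat list list \<Rightarrow> bool" where
  "hub_walk \<beta> s ws \<longleftrightarrow>
     (\<forall>w \<in> set ws. distinct w \<and> standardize w = w) \<and>
     successively (\<lambda>u v. contracts_to \<beta> u v \<or> contracts_to \<beta> v u) ws \<and>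
     s \<in> set ws \<and> length s = 3 \<and>
     (\<forall>p \<in> permutations_of_set {1, 2, 3}. p \<noteq> [1, 2, 3] \<longrightarrow> p \<in> set ws) \<and>
     (\<forall>p \<in> permutations_of_set {1, 2, 3, 4}. standardize (butlast p) \<in> {[1, 2, 3], s} \<longrightarrow> p \<in> set ws)"

lemma successively_imp_related:
  assumes E: "equiv A E" and walk: "successively (\<lambda>u v. (u, v) \<in> E) ws" "set ws \<subseteq> A"
    and uv: "u \<in> set ws" "v \<in> set ws"
  shows "(u, v) \<in> E"
proof -
  have refl: "(x, x) \<in> E" if "x \<in> A" for x using E that by (meson equivE refl_onD)
  have sym: "(y, x) \<in> E" if "(x, y) \<in> E" for x y using E that by (meson equivE symD)
  have trans: "(x, z) \<in> E" if "(x, y) \<in> E" "(y, z) \<in> E" for x y z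
    using E that by (meson equivE transD)
  have hd: "(hd ws, w) \<in> E" if "w \<in> set ws" for w
    using walk that
  proof (induction ws arbitrary: w)
    case (Cons a ws)
    show ?case
    proof (cases "w = a")
      case True
      then show ?thesis using Cons.prems(2) refl by simp
    next
      case False
      then have "w \<in> set ws" using Cons.prems(3) by simp
      moreover from this have "ws \<noteq> []" by auto
      ultimately have "(a, hd ws) \<in> E" "(hd ws, w) \<in> E"
        using Cons by (simp_all add: successively_Cons)
      then show ?thesis using trans by simp
    qed
  qed simp
  show ?thesis using trans[OF sym[OF hd[OF uv(1)]] hd[OF uv(2)]] .
qed

lemma perms_of_length:
  "p \<in> perms \<Longrightarrow> p \<in> permutations_of_set {1..length p}"
  by (simp add: perms_iff permutations_of_set_def)

lemma short_perms:
  assumes "p \<in> perms"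
  shows "length p = 0 \<Longrightarrow> p = []" "length p = 1 \<Longrightarrow> p = [1]" "length p = 2 \<Longrightarrow> p \<in> {[1, 2], [2, 1]}"
proof -
  show "length p = 2 \<Longrightarrow> p \<in> {[1, 2], [2, 1]}"
  proof -
    assume "length p = 2"
    moreover have "{1..2::nat} = {1, 2}" by auto
    ultimately show ?thesis using perms_of_length[OF assms] by (simp add: permutations_of_set_doubleton)
  qed
  show "length p = 1 \<Longrightarrow> p = [1]"
    using perms_of_length[OF assms] by simp
qed simp

text \<open>
  By induction on the length, reducing the first \<open>n\<close> of \<open>n + 1\<close> letters to the hub. The only
  permutation of length at least 3 to which the induction hypothesis does not apply is \<open>123\<close>, and
  the walk contains its extensions by one letter as well.
\<close>

lemma hub_walk_imp_long_equiv:
  assumes \<beta>: "decreasing_pair \<beta>" and walk: "hub_walk \<beta> s ws"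
    and "\<pi> \<in> perms" "3 \<le> length \<pi>" "\<pi> \<noteq> [1, 2, 3]"
  shows "(\<pi>, s) \<in> equiv_under rise \<beta>"
proof -
  let ?E = "equiv_under rise \<beta>"
  have E: "equiv perms ?E" by (rule equiv_equiv_under)
  have sym: "(v, u) \<in> ?E" if "(u, v) \<in> ?E" for u v using E that by (meson equivE symD)
  have trans: "(u, w) \<in> ?E" if "(u, v) \<in> ?E" "(v, w) \<in> ?E" for u v w
    using E that by (meson equivE transD)
  have perms: "set ws \<subseteq> perms"
  proof
    fix w assume "w \<in> set ws"
    then have "distinct w" "standardize w = w" using walk by (auto simp: hub_walk_def)
    then show "w \<in> perms" using standardize_in_perms by metis
  qed
  have "successively (\<lambda>u v. (u, v) \<in> ?E) ws"
  proof (rule successively_mono)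
    show "successively (\<lambda>u v. contracts_to \<beta> u v \<or> contracts_to \<beta> v u) ws"
      using walk by (simp add: hub_walk_def)
    show "(u, v) \<in> ?E" if "u \<in> set ws" "v \<in> set ws" "contracts_to \<beta> u v \<or> contracts_to \<beta> v u" for u v
      using that perms contracts_to_imp_replacement[OF _ _ \<beta>] replacement_imp_equiv_under sym by blast
  qed
  then have walk_equiv: "(w, s) \<in> ?E" if "w \<in> set ws" for w
    using successively_imp_related[OF E _ perms that] walk by (simp add: hub_walk_def)
  have three: "(p, s) \<in> ?E" if "p \<in> perms" "length p = 3" "p \<noteq> [1, 2, 3]" for p
  proof -
    have "{1..3::nat} = {1, 2, 3}" by auto
    then show ?thesis
      using perms_of_length[OF that(1)] that walk walk_equiv by (simp add: hub_walk_def)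
  qed
  have four: "(v @ [l], s) \<in> ?E"
    if "v @ [l] \<in> perms" "length (v @ [l]) = 4" "standardize v \<in> {[1, 2, 3], s}" for v l
  proof -
    have "{1..4::nat} = {1, 2, 3, 4}" by auto
    then have "v @ [l] \<in> permutations_of_set {1, 2, 3, 4}"
      using perms_of_length[OF that(1)] that(2) by simp
    moreover have "standardize (butlast (v @ [l])) \<in> {[1, 2, 3], s}" using that(3) by simp
    ultimately show ?thesis using walk walk_equiv unfolding hub_walk_def by blast
  qed
  have s: "length s = 3" using walk by (simp add: hub_walk_def)
  show ?thesis
    using assms(3-5)
  proof (induction "length \<pi>" arbitrary: \<pi>)
    case (Suc n)
    obtain v l where \<pi>: "\<pi> = v @ [l]" using Suc.hyps(2) by (metis Zero_not_Suc list.size(3) rev_exhaust)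
    have "distinct v" using Suc.prems(1) \<pi> by (simp add: perms_iff)
    then have v: "standardize v \<in> perms" "length (standardize v) = n"
      using Suc.hyps(2) \<pi> standardize_in_perms by simp_all
    consider "n = 2" | "standardize v = [1, 2, 3]" | "3 \<le> n" "standardize v \<noteq> [1, 2, 3]" using Suc by linarith
    then show ?case
    proof cases
      case 1
      then show ?thesis using three Suc by simp
    next
      case 2
      then have "length v = 3" using length_standardize[of v] by simp
      then show ?thesis using four Suc.prems(1) 2 \<pi> by simp
    next
      case 3
      \<comment> \<open>The first letters turn into the hub, with the last letter still behind them.\<close>
      then have "(standardize v, s) \<in> ?E" using Suc.hyps(1) v by simp
      then obtain v' l' where v': "standardize v' = s" "(\<pi>, v' @ [l']) \<in> ?E"
        using equiv_under_snoc Suc.prems(1) unfolding \<pi> by blast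
      then have "v' @ [l'] \<in> perms" by (simp add: equiv_under_def)
      moreover have "length v' = 3" using v'(1) length_standardize[of v'] s by simp
      ultimately have "(v' @ [l'], s) \<in> ?E" using four v'(1) by simp
      then show ?thesis using v'(2) trans by blast
    qed
  qed simp
qed

section \<open>The five classes\<close>

lemma quotient_eqI:
  assumes E: "equiv A E" and cover: "\<Union>X = A" and ne: "{} \<notin> X"
    and closed: "\<And>C x y. C \<in> X \<Longrightarrow> x \<in> C \<Longrightarrow> (x, y) \<in> E \<Longrightarrow> y \<in> C"
    and connected: "\<And>C x y. C \<in> X \<Longrightarrow> x \<in> C \<Longrightarrow> y \<in> C \<Longrightarrow> (x, y) \<in> E"
  shows "A // E = X"
proof -
  have cls: "E `` {x} = C" if "C \<in> X" "x \<in> C" for x C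
    using that closed[of C x] connected[of C x] by blast
  show ?thesis
  proof (intro subset_antisym subsetI)
    fix C assume "C \<in> A // E"
    then obtain x where x: "x \<in> A" "C = E `` {x}" by (rule quotientE)
    then obtain D where "D \<in> X" "x \<in> D" using cover by blast
    then show "C \<in> X" using cls x(2) by simp
  next
    fix C assume C: "C \<in> X"
    then obtain x where "x \<in> C" using ne by fastforce
    then show "C \<in> A // E" using cls C cover by (metis UnionI quotientI)
  qed
qed

lemma hub_walk_imp_quotient:
  assumes \<beta>: "decreasing_pair \<beta>" and walk: "hub_walk \<beta> s ws"
  defines "X \<equiv> {{[]}, {[1]}, {[1, 2]}, {[1, 2, 3], [2, 1]}, perms - {[], [1], [1, 2], [1, 2, 3], [2, 1]}}"
  shows "perms // equiv_under rise \<beta> = X" "card X = 5"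
proof -
  let ?E = "equiv_under rise \<beta>"
  define Rest where "Rest = perms - {[], [1], [1, 2], [1, 2, 3], [2, 1]}"
  have X: "X = {{[]}, {[1]}, {[1, 2]}, {[1, 2, 3], [2, 1]}, Rest}" by (simp add: X_def Rest_def)
  have E: "equiv perms ?E" by (rule equiv_equiv_under)
  have small: "{[], [1], [1, 2], [1, 2, 3], [2, 1]} \<subseteq> perms"
    by (auto simp: perms_iff)
  have Rest: "\<pi> \<in> Rest \<longleftrightarrow> \<pi> \<in> perms \<and> 3 \<le> length \<pi> \<and> \<pi> \<noteq> [1, 2, 3]" for \<pi>
  proof
    assume *: "\<pi> \<in> Rest"
    then have "length \<pi> \<noteq> 0" "length \<pi> \<noteq> 1" "length \<pi> \<noteq> 2"
      using short_perms[of \<pi>] by (auto simp: Rest_def)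
    then have "3 \<le> length \<pi>" by linarith
    then show "\<pi> \<in> perms \<and> 3 \<le> length \<pi> \<and> \<pi> \<noteq> [1, 2, 3]" using * by (auto simp: Rest_def)
  qed (auto simp: Rest_def)
  have closed_step: "\<pi> \<in> C \<longleftrightarrow> \<sigma> \<in> C" if C: "C \<in> X" and r: "replacement rise \<beta> \<pi> \<sigma>" for C \<pi> \<sigma>
  proof -
    note shape = replacement_shape[OF r \<beta>]
    have perm: "\<pi> \<in> perms" "\<sigma> \<in> perms" using r by (simp_all add: replacement_iff_overwrite)
    have ne: "\<sigma> \<noteq> []" "\<sigma> \<noteq> [1]" "\<sigma> \<noteq> [1, 2]" "\<sigma> \<noteq> [1, 2, 3]" using shape by auto
    show ?thesis
    proof (cases "length \<pi> = 3")
      case True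
      then have "\<pi> = [1, 2, 3]" "\<sigma> = [2, 1]" using shape by auto
      moreover have "\<forall>C \<in> X. [1, 2, 3] \<in> C \<longleftrightarrow> [2, 1] \<in> C" by (simp add: X Rest_def)
      ultimately show ?thesis using C by blast
    next
      case False
      then have "\<pi> \<noteq> [1, 2, 3]" by auto
      with False have "\<pi> \<in> Rest" "\<sigma> \<in> Rest" using shape(1,2) perm ne(4) by (simp_all add: Rest)
      moreover have "\<forall>C \<in> X. C = Rest \<or> C \<inter> Rest = {}" by (simp add: X Rest_def)
      ultimately show ?thesis using C by blast
    qed
  qed
  have closed: "\<sigma> \<in> C" if C: "C \<in> X" and "\<pi> \<in> C" "(\<pi>, \<sigma>) \<in> ?E" for C \<pi> \<sigma>
  proof -
    have "(\<lambda>\<tau> \<tau>'. replacement rise \<beta> \<tau> \<tau>' \<or> replacement \<beta> rise \<tau> \<tau>')\<^sup>*\<^sup>* \<pi> \<sigma>"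
      using that by (simp add: equiv_under_def)
    then show ?thesis
    proof induction
      case (step \<tau> \<tau>')
      then show ?case using closed_step[OF C] replacement_sym by blast
    qed (rule that)
  qed
  have mid: "([1, 2, 3], [2, 1]) \<in> ?E"
  proof -
    \<comment> \<open>Whatever \<open>\<beta>\<close> is, the result has length 2 and an inversion.\<close>
    define \<sigma> where "\<sigma> = contraction \<beta> [1, 2, 3] 0 1 2"
    have "contracts_to \<beta> [1, 2, 3] \<sigma>"
      unfolding contracts_to_def \<sigma>_def
      by (intro bexI[of _ 2] bexI[of _ 1] bexI[of _ 0]) auto
    then have r: "replacement rise \<beta> [1, 2, 3] \<sigma>"
      using contracts_to_imp_replacement[OF _ _ \<beta>] small by blast
    then have "\<sigma> = [2, 1]" using replacement_shape(2,5)[OF r \<beta>] by simp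
    then show ?thesis using r replacement_imp_equiv_under by simp
  qed
  have sym: "(\<sigma>, \<pi>) \<in> ?E" if "(\<pi>, \<sigma>) \<in> ?E" for \<pi> \<sigma>
    using E that by (meson equivE symD)
  have connected: "(\<pi>, \<sigma>) \<in> ?E" if C: "C \<in> X" and \<pi>\<sigma>: "\<pi> \<in> C" "\<sigma> \<in> C" for C \<pi> \<sigma>
  proof (cases "C = Rest")
    case True
    then have "(\<pi>, s) \<in> ?E" "(\<sigma>, s) \<in> ?E"
      using \<pi>\<sigma> hub_walk_imp_long_equiv[OF \<beta> walk] Rest by blast+
    then show ?thesis using sym E by (meson equivE transD)
  next
    case False
    then consider "\<pi> = \<sigma>" | "\<pi> = [1, 2, 3]" "\<sigma> = [2, 1]" | "\<pi> = [2, 1]" "\<sigma> = [1, 2, 3]"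
      using C \<pi>\<sigma> unfolding X by blast
    moreover have "\<pi> \<in> perms" using C \<pi>\<sigma>(1) False small unfolding X by blast
    ultimately show ?thesis using mid sym by cases (auto simp: equiv_under_def)
  qed
  have r321: "[3, 2, 1] \<in> Rest" by (auto simp: Rest_def perms_iff)
  show "perms // ?E = X"
  proof (rule quotient_eqI[OF E])
    show "\<Union>X = perms" using small by (auto simp: X Rest_def)
    show "{} \<notin> X" using r321 by (auto simp: X)
  qed (use closed connected in blast)+
  have "[] \<notin> Rest" "[1] \<notin> Rest" "[1, 2] \<notin> Rest" "[1, 2, 3] \<notin> Rest" by (auto simp: Rest_def)
  then have "{[]} \<noteq> Rest" "{[1]} \<noteq> Rest" "{[1, 2]} \<noteq> Rest" "{[1, 2, 3], [2, 1]} \<noteq> Rest" by auto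
  then show "card X = 5" unfolding X by (simp add: doubleton_eq_iff)
qed

section \<open>Hub walks for the nine patterns\<close>

text \<open>
  The walks come from a breadth-first search among the permutations of length 3, 4 and 5, choosing
  as hub a permutation whose walk is short. In the lemma names, \<open>x\<close> stands for the star.
\<close>

lemma hub_walk_x31:
  "hub_walk [Star, Num 3, Num 1] [2,1,3]
     [[2,1,3], [1,2,3,4], [3,2,1], [2,3,4,1], [1,2,3,5,4], [3,2,4,1], [3,1,2,4,5], [3,1,4,2],
     [2,3,1,4,5], [2,1,4,3], [1,2,3,5,4], [1,3,4,2], [3,1,2], [1,2,4,3], [2,3,1], [2,1,3,4],
     [1,3,2]]"
  by code_simp

lemma hub_walk_3x1:
  "hub_walk [Num 3, Star, Num 1] [3,1,2]
     [[4,2,3,1], [1,3,2,4,5], [1,3,4,2], [3,1,2], [1,2,4,3], [2,3,1], [3,1,2,4], [2,1,3,4,5],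
     [4,1,3,2], [2,3,1,4,5], [2,3,4,1], [3,2,1], [4,1,2,3], [3,2,1], [1,2,3,4], [2,1,3],
     [1,2,3,4], [1,3,2]]"
  by code_simp

lemma hub_walk_31x:
  "hub_walk [Num 3, Num 1, Star] [2,1,3]
     [[3,2,4,1], [1,2,5,3,4], [2,1,4,3], [1,2,5,3,4], [1,3,4,2], [1,2,5,3,4], [3,1,4,2],
     [2,1,5,3,4], [2,3,4,1], [3,2,1], [1,2,3,4], [1,3,2], [1,2,3,4], [2,1,3], [1,2,4,3], [3,1,2],
     [2,1,3,4], [2,3,1]]"
  by code_simp

lemma hub_walk_x32:
  "hub_walk [Star, Num 3, Num 2] [1,3,2]
     [[3,1,2], [1,3,2,4], [2,3,1], [1,2,4,3], [1,3,2,4,5], [2,4,3,1], [1,3,4,5,2], [1,4,3,2],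
     [1,2,4,5,3], [2,3,4,1], [3,2,1], [1,4,2,3], [3,2,1], [1,3,4,2], [3,2,1], [1,2,3,4], [2,1,3],
     [1,2,3,4], [1,3,2]]"
  by code_simp

lemma hub_walk_3x2:
  "hub_walk [Num 3, Star, Num 2] [2,1,3]
     [[3,2,4,1], [1,2,3,5,4], [2,1,4,3], [1,2,3,5,4], [3,1,4,2], [1,2,4,5,3], [2,3,4,1], [3,2,1],
     [1,3,4,2], [1,2,3,5,4], [1,4,2,3], [2,3,1], [1,2,4,3], [3,1,2], [2,1,3,4], [1,3,2],
     [1,2,3,4], [2,1,3]]"
  by code_simp

lemma hub_walk_32x:
  "hub_walk [Num 3, Num 2, Star] [1,3,2]
     [[2,4,3,1], [2,3,4,1,5], [3,2,1,4], [1,3,4,2,5], [1,4,3,2], [1,2,4,3,5], [3,1,2,4], [2,3,1],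
     [1,4,2,3], [1,2,3,4,5], [1,2,4,3], [3,1,2], [1,2,3,4], [2,1,3], [1,2,3,4], [1,3,2],
     [2,1,3,4], [1,2,3,4,5], [1,3,2,4], [3,2,1], [2,3,4,1], [3,2,1], [1,3,4,2]]"
  by code_simp

lemma hub_walk_x21:
  "hub_walk [Star, Num 2, Num 1] [2,1,3]
     [[3,2,1], [2,3,4,1], [2,3,1,4,5], [3,1,4,2], [3,1,2,4,5], [3,2,4,1], [3,2,1,4,5], [2,1,4,3],
     [1,2,3,5,4], [1,3,4,2], [3,1,2], [1,3,4,2], [1,2,3,4,5], [2,1,3,4], [2,3,1], [1,2,4,3],
     [2,1,3], [1,2,3,4], [1,3,2]]"
  by code_simp

lemma hub_walk_2x1:
  "hub_walk [Num 2, Star, Num 1] [1,3,2]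
     [[3,1,2], [1,3,4,2], [1,2,4,3,5], [2,4,3,1], [1,2,4,3,5], [1,4,3,2], [1,2,3,4,5], [2,3,4,1],
     [3,2,1], [1,3,2,4], [2,3,1], [1,4,2,3], [2,3,1], [1,2,4,3], [2,1,3], [1,2,3,4], [1,3,2]]"
  by code_simp

lemma hub_walk_21x:
  "hub_walk [Num 2, Num 1, Star] [2,1,3]
     [[3,1,4,2], [1,3,4,2,5], [2,3,4,1], [3,2,1], [1,2,3,4], [1,3,2], [1,2,3,4], [2,1,3],
     [1,2,4,3], [1,2,3,4,5], [2,1,3,4], [2,3,1], [1,3,2,4], [3,1,2], [1,3,4,2], [1,2,4,3,5],
     [3,2,4,1], [1,2,4,3,5], [2,1,4,3]]"
  by code_simp

theorem theorem13:
  fixes \<beta> :: "symb list"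
  assumes "\<beta> \<in> {[Star, Num 3, Num 1], [Num 3, Star, Num 1], [Num 3, Num 1, Star],
                 [Star, Num 3, Num 2], [Num 3, Star, Num 2], [Num 3, Num 2, Star],
                 [Star, Num 2, Num 1], [Num 2, Star, Num 1], [Num 2, Num 1, Star]}"
  shows "perms // equiv_under [Num 1, Num 2, Num 3] \<beta> =
           {{[]}, {[1]}, {[1, 2]}, {[1, 2, 3], [2, 1]},
            perms - {[], [1], [1, 2], [1, 2, 3], [2, 1]}}
         \<and> card (perms // equiv_under [Num 1, Num 2, Num 3] \<beta>) = 5"
proof -
  have "decreasing_pair \<beta>"
    using assms by (auto simp: decreasing_pair_def)
  moreover obtain s ws where "hub_walk \<beta> s ws"
    using assms hub_walk_x31 hub_walk_3x1 hub_walk_31x hub_walk_x32 hub_walk_3x2 hub_walk_32x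
      hub_walk_x21 hub_walk_2x1 hub_walk_21x by blast
  ultimately show ?thesis
    using hub_walk_imp_quotient[of \<beta> s ws] by simp
qed

end
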